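(* Let $(\sigma_k)_{k\in\mathbb{N}}$ be positive reals with $\sum_{k=1}^\infty \sigma_k^2<\infty$, and let $(H_k)_{k\in\mathbb{N}}$ be pairwise distinct numbers in $(0,1)$ with $\inf_k H_k>0$ and $\sup_k H_k<1$. Let $B^{H_k}=(B^{H_k}_t)_{t\ge 0}$, $k\in\mathbb{N}$, be independent fractional Brownian motions with Hurst indices $H_k$, defined on a common probability space $(\Omega,\mathcal{F},\mathbb{P})$. Then for every $T>0$ the multi-mixed fractional Brownian motion $$M=\sum_{k=1}^\infty \sigma_k B^{H_k}$$ exists as an element of $L^2(\Omega\times[0,T])$, i.e. the partial sums $M^n=\sum_{k=1}^n\sigma_k B^{H_k}$ converge in $L^2(\Omega\times[0,T])$ (with respect to $\mathbb{P}\otimes \mathrm{Lebesgue}$) as $n\to\infty$.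
   Context: A fractional Brownian motion (fBm) with Hurst index $H\in(0,1)$ is a centered Gaussian process with continuous paths and covariance $\mathbb{E}[B^H_tB^H_s]=\frac12\left(|t|^{2H}+|s|^{2H}-|t-s|^{2H}\right)$. *)

theory Defs
  imports "HOL-Probability.Probability"
begin

text \<open>Point masses count as (degenerate) Gaussian laws. This is needed because fractional
  Brownian motion vanishes almost surely at time 0.\<close>

definition gaussian_law :: "real \<Rightarrow> real \<Rightarrow> real measure" where
  "gaussian_law \<mu> s =
     (if s = 0 then return borel \<mu> else density lborel (\<lambda>x. ennreal (normal_density \<mu> s x)))"

definition gaussian_rv :: "'a measure \<Rightarrow> ('a \<Rightarrow> real) \<Rightarrow> bool" where
  "gaussian_rv P X \<longleftrightarrow>
     X \<in> borel_measurable P \<and> (\<exists>\<mu> s. s \<ge> 0 \<and> distr P borel X = gaussian_law \<mu> s)"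

text \<open>The finite-dimensional marginals are multivariate normal (possibly degenerate), i.e. every
  finite linear combination of the marginals is a Gaussian random variable.\<close>

definition gaussian_process :: "'a measure \<Rightarrow> 'i set \<Rightarrow> ('i \<Rightarrow> 'a \<Rightarrow> real) \<Rightarrow> bool" where
  "gaussian_process P I X \<longleftrightarrow>
     (\<forall>F c. finite F \<longrightarrow> F \<subseteq> I \<longrightarrow> gaussian_rv P (\<lambda>\<omega>. \<Sum>t\<in>F. c t * X t \<omega>))"

text \<open>Time runs over the half-line \<open>{0..}\<close>; the values of \<open>B\<close> at negative times are irrelevant.
  All paths, not merely almost all of them, are required to be continuous.\<close>

definition fractional_brownian_motion :: "'a measure \<Rightarrow> real \<Rightarrow> (real \<Rightarrow> 'a \<Rightarrow> real) \<Rightarrow> bool" where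
  "fractional_brownian_motion P H B \<longleftrightarrow>
     0 < H \<and> H < 1 \<and>
     gaussian_process P {0..} B \<and>
     (\<forall>t\<ge>0. (\<integral>\<omega>. B t \<omega> \<partial>P) = 0) \<and>
     (\<forall>t\<ge>0. \<forall>s\<ge>0. (\<integral>\<omega>. B t \<omega> * B s \<omega> \<partial>P)
        = (\<bar>t\<bar> powr (2 * H) + \<bar>s\<bar> powr (2 * H) - \<bar>t - s\<bar> powr (2 * H)) / 2) \<and>
     (\<forall>\<omega>\<in>space P. continuous_on {0..} (\<lambda>t. B t \<omega>))"

text \<open>Independence of whole processes: each process is viewed as a single random variable with
  values in the path space \<open>\<real>\<^bsup>[0,\<infinity>)\<^esup>\<close> equipped with the product sigma-algebra.\<close>

definition independent_processes ::
  "'a measure \<Rightarrow> (nat \<Rightarrow> real \<Rightarrow> 'a \<Rightarrow> real) \<Rightarrow> nat set \<Rightarrow> bool" where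
  "independent_processes P B K \<longleftrightarrow>
     prob_space.indep_vars P (\<lambda>_. Pi\<^sub>M {0..} (\<lambda>_. borel)) (\<lambda>k \<omega>. \<lambda>t\<in>{0..}. B k t \<omega>) K"

definition square_integrable :: "'b measure \<Rightarrow> ('b \<Rightarrow> real) \<Rightarrow> bool" where
  "square_integrable N f \<longleftrightarrow> f \<in> borel_measurable N \<and> integrable N (\<lambda>x. (f x)\<^sup>2)"

definition L2_seminorm :: "'b measure \<Rightarrow> ('b \<Rightarrow> real) \<Rightarrow> real" where
  "L2_seminorm N f = sqrt (\<integral>x. (f x)\<^sup>2 \<partial>N)"

definition converges_in_L2 :: "'b measure \<Rightarrow> (nat \<Rightarrow> 'b \<Rightarrow> real) \<Rightarrow> ('b \<Rightarrow> real) \<Rightarrow> bool" where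
  "converges_in_L2 N f g \<longleftrightarrow>
     (\<forall>n. square_integrable N (f n)) \<and> square_integrable N g \<and>
     (\<lambda>n. L2_seminorm N (\<lambda>x. f n x - g x)) \<longlonglongrightarrow> 0"

end

theory Submission
  imports Defs
begin

text \<open>Independent centred summands are orthogonal in \<open>L\<^sup>2(P)\<close> at each fixed time, and
  \<open>t powr (2 * H) \<le> (1 + T)\<^sup>2\<close> uniformly in \<open>H \<in> (0, 1)\<close> and \<open>t \<in> [0, T]\<close>. By Fubini the squared
  norm of a block of the series is therefore at most \<open>(1 + T)\<^sup>2 T\<close> times the corresponding block of
  \<open>\<Sum>k. (\<sigma> k)\<^sup>2\<close>, so the partial sums are Cauchy, and \<open>L\<^sup>2\<close> is complete.\<close>

section \<open>Square-integrable functions and completeness of L^2 over a finite measure\<close>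

lemma square_integrable_diff:
  assumes "square_integrable M f" "square_integrable M g"
  shows "square_integrable M (\<lambda>x. f x - g x)"
proof -
  have [measurable]: "f \<in> borel_measurable M" "g \<in> borel_measurable M"
    using assms by (auto simp: square_integrable_def)
  \<comment> \<open>The right side exceeds the left by exactly
    \<open>(a + b)\<^sup>2\<close>.\<close>
  have bound: "(a - b)\<^sup>2 \<le> 2 * a\<^sup>2 + 2 * b\<^sup>2" for a b :: real
    using zero_le_power2[of "a + b"] by (simp add: power2_eq_square algebra_simps)
  have "integrable M (\<lambda>x. (f x - g x)\<^sup>2)"
  proof (rule Bochner_Integration.integrable_bound)
    show "integrable M (\<lambda>x. 2 * (f x)\<^sup>2 + 2 * (g x)\<^sup>2)"
      using assms by (simp add: square_integrable_def)
    show "AE x in M. norm ((f x - g x)\<^sup>2) \<le> norm (2 * (f x)\<^sup>2 + 2 * (g x)\<^sup>2)"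
      using bound by simp
  qed measurable
  then show ?thesis
    by (simp add: square_integrable_def)
qed

lemma square_integrable_mult:
  assumes "square_integrable M f" "square_integrable M g"
  shows "integrable M (\<lambda>x. f x * g x)"
proof -
  have [measurable]: "f \<in> borel_measurable M" "g \<in> borel_measurable M"
    using assms by (auto simp: square_integrable_def)
  have bound: "\<bar>a * b\<bar> \<le> a\<^sup>2 + b\<^sup>2" for a b :: real
  proof -
    have "0 \<le> (\<bar>a\<bar> - \<bar>b\<bar>)\<^sup>2" "0 \<le> \<bar>a\<bar> * \<bar>b\<bar>"
      by auto
    then show ?thesis
      unfolding power2_diff abs_mult power2_abs by linarith
  qed
  show ?thesis
  proof (rule Bochner_Integration.integrable_bound)
    show "integrable M (\<lambda>x. (f x)\<^sup>2 + (g x)\<^sup>2)"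
      using assms by (simp add: square_integrable_def)
    show "AE x in M. norm (f x * g x) \<le> norm ((f x)\<^sup>2 + (g x)\<^sup>2)"
      using bound by simp
  qed measurable
qed

text \<open>Cauchy-Schwarz against the constant 1. On a finite measure it turns L^2 estimates into
  L^1 estimates, which gives access to almost everywhere convergence of a subsequence.\<close>

lemma (in finite_measure) L1_le_L2:
  assumes "square_integrable M h"
  shows "(\<integral>x. \<bar>h x\<bar> \<partial>M)\<^sup>2 \<le> (\<integral>x. (h x)\<^sup>2 \<partial>M) * measure M (space M)"
proof -
  have [measurable]: "h \<in> borel_measurable M" and sq: "integrable M (\<lambda>x. (h x)\<^sup>2)"
    using assms by (auto simp: square_integrable_def)
  have int: "integrable M (\<lambda>x. \<bar>h x\<bar>)"
    using square_integrable_imp_integrable[OF _ sq] by auto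
  have "(\<integral>\<^sup>+x. ennreal \<bar>h x\<bar> * 1 \<partial>M)\<^sup>2 \<le> (\<integral>\<^sup>+x. (ennreal \<bar>h x\<bar>)\<^sup>2 \<partial>M) * (\<integral>\<^sup>+x. 1\<^sup>2 \<partial>M)"
    by (rule Cauchy_Schwarz_nn_integral) auto
  also have "(\<integral>\<^sup>+x. ennreal \<bar>h x\<bar> * 1 \<partial>M) = ennreal (\<integral>x. \<bar>h x\<bar> \<partial>M)"
    using int by (simp add: nn_integral_eq_integral)
  also have "(\<integral>\<^sup>+x. (ennreal \<bar>h x\<bar>)\<^sup>2 \<partial>M) = ennreal (\<integral>x. (h x)\<^sup>2 \<partial>M)"
    using sq by (simp add: ennreal_power nn_integral_eq_integral)
  finally show ?thesis
    by (simp add: ennreal_power emeasure_eq_measure flip: ennreal_mult)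
qed

text \<open>The Riesz-Fischer argument: an L^2-Cauchy sequence is L^1-Cauchy because the measure is
  finite, so a subsequence converges almost everywhere, and Fatou's lemma carries the Cauchy bound
  over to its limit.\<close>

lemma (in finite_measure) L2_complete:
  fixes f :: "nat \<Rightarrow> 'a \<Rightarrow> real"
  assumes sq: "\<And>n. square_integrable M (f n)"
    and cauchy: "\<And>e. e > 0 \<Longrightarrow> \<exists>N. \<forall>m\<ge>N. \<forall>n\<ge>N. (\<integral>x. (f m x - f n x)\<^sup>2 \<partial>M) \<le> e"
  obtains g where "converges_in_L2 M f g"
proof -
  have [measurable]: "f n \<in> borel_measurable M" for n
    using sq by (auto simp: square_integrable_def)
  have sq_diff: "square_integrable M (\<lambda>x. f m x - f n x)" for m n
    by (intro square_integrable_diff sq)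
  have "integrable M (f n)" for n
    using sq by (auto simp: square_integrable_def intro: square_integrable_imp_integrable)
  moreover have "\<exists>N. \<forall>m\<ge>N. \<forall>n\<ge>N. (\<integral>x. norm (f m x - f n x) \<partial>M) < e" if "e > 0" for e
  proof -
    \<comment> \<open>Adding 1 keeps the divisor positive even when the total mass is 0.\<close>
    define c where "c = measure M (space M) + 1"
    have c: "c > 0" "measure M (space M) \<le> c"
      by (auto simp: c_def add_nonneg_pos)
    \<comment> \<open>Aiming at \<open>e/2\<close> leaves room for the strict inequality required at
      the end.\<close>
    obtain N where N: "\<And>m n. m \<ge> N \<Longrightarrow> n \<ge> N \<Longrightarrow> (\<integral>x. (f m x - f n x)\<^sup>2 \<partial>M) \<le> (e/2)\<^sup>2 / c"
      using cauchy[of "(e/2)\<^sup>2 / c"] \<open>e > 0\<close> c by auto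
    have "(\<integral>x. norm (f m x - f n x) \<partial>M) < e" if "m \<ge> N" "n \<ge> N" for m n
    proof -
      have "(\<integral>x. \<bar>f m x - f n x\<bar> \<partial>M)\<^sup>2 \<le> (\<integral>x. (f m x - f n x)\<^sup>2 \<partial>M) * measure M (space M)"
        by (rule L1_le_L2[OF sq_diff])
      also have "\<dots> \<le> (e/2)\<^sup>2 / c * c"
        using N[OF that] c by (intro mult_mono) auto
      also have "\<dots> = (e/2)\<^sup>2"
        using c by simp
      finally have "(\<integral>x. \<bar>f m x - f n x\<bar> \<partial>M) \<le> e/2"
        using \<open>e > 0\<close> by (rule_tac power2_le_imp_le) auto
      then show ?thesis
        using \<open>e > 0\<close> by simp
    qed
    then show ?thesis
      by blast
  qed
  ultimately obtain r where r: "strict_mono r" and AE_Cauchy: "AE x in M. Cauchy (\<lambda>i. f (r i) x)"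
    by (rule cauchy_L1_AE_cauchy_subseq)
  \<comment> \<open>Where the subsequence diverges the value of \<open>lim\<close> is arbitrary, but
    this happens only on a null set.\<close>
  define g where "g x = lim (\<lambda>i. f (r i) x)" for x
  have [measurable]: "g \<in> borel_measurable M"
    unfolding g_def by measurable
  have lim: "AE x in M. (\<lambda>i. f (r i) x) \<longlonglongrightarrow> g x"
    using AE_Cauchy by eventually_elim (simp add: g_def Cauchy_convergent_iff convergent_LIMSEQ_iff)
  \<comment> \<open>Stated with the extended nonnegative integral, since square integrability of
    \<open>f n - g\<close> is not known yet; it will follow from this very bound.\<close>
  have fatou: "\<exists>N. \<forall>n\<ge>N. (\<integral>\<^sup>+x. ennreal ((f n x - g x)\<^sup>2) \<partial>M) \<le> ennreal e" if "e > 0" for e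
  proof -
    obtain N where N: "\<And>m n. m \<ge> N \<Longrightarrow> n \<ge> N \<Longrightarrow> (\<integral>x. (f m x - f n x)\<^sup>2 \<partial>M) \<le> e"
      using cauchy \<open>e > 0\<close> by blast
    have "(\<integral>\<^sup>+x. ennreal ((f n x - g x)\<^sup>2) \<partial>M) \<le> ennreal e" if "n \<ge> N" for n
    proof -
      have "AE x in M. ennreal ((f n x - g x)\<^sup>2) = liminf (\<lambda>i. ennreal ((f n x - f (r i) x)\<^sup>2))"
        using lim
      proof eventually_elim
        case (elim x)
        then have "(\<lambda>i. ennreal ((f n x - f (r i) x)\<^sup>2)) \<longlonglongrightarrow> ennreal ((f n x - g x)\<^sup>2)"
          by (intro tendsto_intros)
        then show ?case
          by (simp add: lim_imp_Liminf del: tendsto_ennreal_iff)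
      qed
      then have "(\<integral>\<^sup>+x. ennreal ((f n x - g x)\<^sup>2) \<partial>M)
          = (\<integral>\<^sup>+x. liminf (\<lambda>i. ennreal ((f n x - f (r i) x)\<^sup>2)) \<partial>M)"
        by (rule nn_integral_cong_AE)
      also have "\<dots> \<le> liminf (\<lambda>i. \<integral>\<^sup>+x. ennreal ((f n x - f (r i) x)\<^sup>2) \<partial>M)"
        by (rule nn_integral_liminf) auto
      also have "\<dots> \<le> ennreal e"
      proof (rule Liminf_le)
        have "(\<integral>\<^sup>+x. ennreal ((f n x - f (r i) x)\<^sup>2) \<partial>M) \<le> ennreal e" if "i \<ge> N" for i
        proof -
          \<comment> \<open>A strictly increasing \<open>r\<close> satisfies
            \<open>r i \<ge> i\<close>, so the subsequence stays in the Cauchy range.\<close>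
          have "r i \<ge> N"
            using that seq_suble[OF r, of i] by simp
          then show ?thesis
            using N[OF \<open>n \<ge> N\<close>] sq_diff
            by (subst nn_integral_eq_integral) (auto simp: square_integrable_def intro: ennreal_leI)
        qed
        then show "\<forall>\<^sub>F i in sequentially. (\<integral>\<^sup>+x. ennreal ((f n x - f (r i) x)\<^sup>2) \<partial>M) \<le> ennreal e"
          by (auto simp: eventually_sequentially)
      qed simp
      finally show ?thesis .
    qed
    then show ?thesis
      by blast
  qed
  have sq_fg: "square_integrable M (\<lambda>x. f n x - g x)"
    if "(\<integral>\<^sup>+x. ennreal ((f n x - g x)\<^sup>2) \<partial>M) \<le> ennreal e" for n e
    using that unfolding square_integrable_def
    by (auto intro!: integrableI_bounded simp: order.strict_trans1)
  \<comment> \<open>One index at finite distance from \<open>g\<close> suffices, because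
    \<open>g\<close> is \<open>f n\<close> minus the difference \<open>f n - g\<close>.\<close>
  obtain n where "square_integrable M (\<lambda>x. f n x - g x)"
    using fatou[OF zero_less_one] sq_fg by (metis order_refl)
  from square_integrable_diff[OF sq[of n] this] have "square_integrable M g"
    by simp
  moreover have "(\<lambda>n. L2_seminorm M (\<lambda>x. f n x - g x)) \<longlonglongrightarrow> 0"
  proof (rule LIMSEQ_I)
    fix e :: real
    assume "e > 0"
    then obtain N where N: "\<And>n. n \<ge> N \<Longrightarrow> (\<integral>\<^sup>+x. ennreal ((f n x - g x)\<^sup>2) \<partial>M) \<le> ennreal ((e/2)\<^sup>2)"
      using fatou[of "(e/2)\<^sup>2"] by auto
    have "L2_seminorm M (\<lambda>x. f n x - g x) < e" if "n \<ge> N" for n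
    proof -
      have "(\<integral>x. (f n x - g x)\<^sup>2 \<partial>M) \<le> (e/2)\<^sup>2"
        using N[OF that] sq_fg[OF N[OF that]]
        by (subst (asm) nn_integral_eq_integral) (auto simp: square_integrable_def)
      then have "L2_seminorm M (\<lambda>x. f n x - g x) \<le> e/2"
        unfolding L2_seminorm_def using \<open>e > 0\<close> by (intro real_le_lsqrt) auto
      then show ?thesis
        using \<open>e > 0\<close> by simp
    qed
    then show "\<exists>N. \<forall>n\<ge>N. norm (L2_seminorm M (\<lambda>x. f n x - g x) - 0) < e"
      by (auto simp: L2_seminorm_def)
  qed
  ultimately show ?thesis
    using sq by (intro that) (auto simp: converges_in_L2_def)
qed

section \<open>Joint measurability of processes with continuous paths\<close>

text \<open>The process is the pointwise limit of its discretisations at the times \<open>j / (n + 1)\<close>.\<close>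

lemma continuous_paths_measurable_pair:
  fixes X :: "real \<Rightarrow> 'a \<Rightarrow> real"
  assumes meas: "\<And>t. t \<ge> 0 \<Longrightarrow> X t \<in> borel_measurable M"
    and cont: "\<And>\<omega>. \<omega> \<in> space M \<Longrightarrow> continuous_on {0..} (\<lambda>t. X t \<omega>)"
    and "A \<subseteq> {0..}"
  shows "(\<lambda>(\<omega>, t). X t \<omega>) \<in> borel_measurable (M \<Otimes>\<^sub>M restrict_space lborel A)"
    (is "_ \<in> borel_measurable ?N")
proof -
  \<comment> \<open>Time is rounded down to a grid of mesh \<open>1 / (n + 1)\<close>. Going through
    \<open>nat\<close> makes the grid index a natural number and keeps the rounded time in
    \<open>{0..}\<close>, where \<open>X\<close> is controlled.\<close>
  define d :: "nat \<Rightarrow> real \<Rightarrow> real" where "d n t = real (nat \<lfloor>real (Suc n) * t\<rfloor>) / real (Suc n)" for n t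
  have [measurable]: "(\<lambda>p. snd p) \<in> ?N \<rightarrow>\<^sub>M borel"
    by (rule measurable_compose[OF measurable_snd])
       (auto intro: measurable_restrict_space1)
  show ?thesis
  proof (rule borel_measurable_LIMSEQ_real)
    fix n
    \<comment> \<open>The rounded time takes countably many values, and for each fixed value the map
      depends on the sample point alone, so the countably many measurable pieces can be
      glued.\<close>
    show "(\<lambda>p. X (d n (snd p)) (fst p)) \<in> borel_measurable ?N"
      unfolding d_def
      by (rule measurable_compose_countable[where f = "\<lambda>i p. X (real i / real (Suc n)) (fst p)"])
         (auto intro!: measurable_compose[OF measurable_fst] meas, measurable)
  next
    fix p
    assume "p \<in> space ?N"
    then obtain \<omega> t where p: "p = (\<omega>, t)" "\<omega> \<in> space M" "t \<ge> 0"
      using \<open>A \<subseteq> {0..}\<close> by (auto simp: space_pair_measure space_restrict_space)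
    have "(\<lambda>n. d n t) \<longlonglongrightarrow> t"
    \<comment> \<open>Rounding down loses at most one mesh width.\<close>
    proof (rule tendsto_sandwich)
      show "(\<lambda>n. t - 1 / real (Suc n)) \<longlonglongrightarrow> t"
        using tendsto_diff[OF tendsto_const LIMSEQ_Suc[OF lim_1_over_n]] by simp
      have d_eq: "d n t = of_int \<lfloor>real (Suc n) * t\<rfloor> / real (Suc n)" for n
        using \<open>t \<ge> 0\<close> by (simp add: d_def)
      have "t - 1 / real (Suc n) \<le> d n t" for n
      proof -
        have "t - 1 / real (Suc n) = (real (Suc n) * t - 1) / real (Suc n)"
          by (simp add: diff_divide_distrib del: of_nat_Suc)
        also have "\<dots> \<le> d n t"
          unfolding d_eq by (intro divide_right_mono) linarith+
        finally show ?thesis .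
      qed
      then show "\<forall>\<^sub>F n in sequentially. t - 1 / real (Suc n) \<le> d n t"
        by simp
      have "d n t \<le> real (Suc n) * t / real (Suc n)" for n
        unfolding d_eq by (intro divide_right_mono) linarith+
      then show "\<forall>\<^sub>F n in sequentially. d n t \<le> t"
        by (simp del: of_nat_Suc)
    qed simp
    then have "(\<lambda>n. X (d n t) \<omega>) \<longlonglongrightarrow> X t \<omega>"
      by (rule continuous_on_tendsto_compose[OF cont[OF p(2)]]) (use \<open>t \<ge> 0\<close> in \<open>auto simp: d_def\<close>)
    then show "(\<lambda>n. X (d n (snd p)) (fst p)) \<longlonglongrightarrow> (case p of (\<omega>, t) \<Rightarrow> X t \<omega>)"
      by (simp add: p)
  qed
qed

section \<open>Second moments of orthogonal sums\<close>

lemma uncorrelated_sum_square: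
  fixes X :: "'i \<Rightarrow> 'a \<Rightarrow> real"
  assumes "finite A"
    and sq: "\<And>i. i \<in> A \<Longrightarrow> square_integrable M (X i)"
    and uncorr: "\<And>i j. i \<in> A \<Longrightarrow> j \<in> A \<Longrightarrow> i \<noteq> j \<Longrightarrow> (\<integral>x. X i x * X j x \<partial>M) = 0"
  shows "square_integrable M (\<lambda>x. \<Sum>i\<in>A. X i x)"
    and "(\<integral>x. (\<Sum>i\<in>A. X i x)\<^sup>2 \<partial>M) = (\<Sum>i\<in>A. \<integral>x. (X i x)\<^sup>2 \<partial>M)"
proof -
  have square: "(\<Sum>i\<in>A. X i x)\<^sup>2 = (\<Sum>i\<in>A. \<Sum>j\<in>A. X i x * X j x)" for x
    by (simp add: power2_eq_square sum_product)
  have int: "integrable M (\<lambda>x. X i x * X j x)" if "i \<in> A" "j \<in> A" for i j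
    using that by (intro square_integrable_mult sq)
  show "square_integrable M (\<lambda>x. \<Sum>i\<in>A. X i x)"
    unfolding square_integrable_def square
  proof
    show "(\<lambda>x. \<Sum>i\<in>A. X i x) \<in> borel_measurable M"
      using sq by (intro borel_measurable_sum) (auto simp: square_integrable_def)
  qed (intro Bochner_Integration.integrable_sum int)
  have "(\<integral>x. (\<Sum>i\<in>A. X i x)\<^sup>2 \<partial>M) = (\<Sum>i\<in>A. \<Sum>j\<in>A. \<integral>x. X i x * X j x \<partial>M)"
    unfolding square using int by (simp add: Bochner_Integration.integral_sum)
  \<comment> \<open>Only the diagonal of the double sum survives.\<close>
  also have "\<dots> = (\<Sum>i\<in>A. \<Sum>j\<in>A. if i = j then \<integral>x. (X i x)\<^sup>2 \<partial>M else 0)"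
    using uncorr by (intro sum.cong refl) (auto simp: power2_eq_square)
  also have "\<dots> = (\<Sum>i\<in>A. \<integral>x. (X i x)\<^sup>2 \<partial>M)"
    using \<open>finite A\<close> by simp
  finally show "(\<integral>x. (\<Sum>i\<in>A. X i x)\<^sup>2 \<partial>M) = (\<Sum>i\<in>A. \<integral>x. (X i x)\<^sup>2 \<partial>M)" .
qed

section \<open>Fractional Brownian motion: moments, correlations and bounds for finite sums\<close>

lemma gaussian_process_measurable:
  assumes "gaussian_process P I X" "t \<in> I"
  shows "X t \<in> borel_measurable P"
proof -
  \<comment> \<open>A one-term linear combination with coefficient 1 recovers the marginal
    itself.\<close>
  have "gaussian_rv P (\<lambda>\<omega>. \<Sum>s\<in>{t}. 1 * X s \<omega>)"
    using assms(1)[unfolded gaussian_process_def, rule_format, of "{t}" "\<lambda>_. 1"] assms(2) by blast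
  then show ?thesis
    by (simp add: gaussian_rv_def)
qed

lemma fractional_brownian_motion_measurable:
  assumes "fractional_brownian_motion P H B" "t \<ge> 0"
  shows "B t \<in> borel_measurable P"
proof (rule gaussian_process_measurable)
  show "gaussian_process P {0..} B"
    using assms(1) unfolding fractional_brownian_motion_def by blast
qed (use assms(2) in simp)

text \<open>Integrability of \<open>(B t)\<^sup>2\<close> follows from its nonzero integral, since the integral of a
  non-integrable function is 0; this is why \<open>t = 0\<close> is excluded.\<close>

lemma fractional_brownian_motion_second_moment:
  assumes "fractional_brownian_motion P H B" "t > 0"
  shows "square_integrable P (B t)" "(\<integral>\<omega>. (B t \<omega>)\<^sup>2 \<partial>P) = t powr (2 * H)"
proof -
  have "(\<integral>\<omega>. B t \<omega> * B t \<omega> \<partial>P)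
      = (\<bar>t\<bar> powr (2 * H) + \<bar>t\<bar> powr (2 * H) - \<bar>t - t\<bar> powr (2 * H)) / 2"
    using assms unfolding fractional_brownian_motion_def by (blast intro: less_imp_le)
  then show moment: "(\<integral>\<omega>. (B t \<omega>)\<^sup>2 \<partial>P) = t powr (2 * H)"
    using \<open>t > 0\<close> by (simp add: power2_eq_square)
  have "integrable P (\<lambda>\<omega>. (B t \<omega>)\<^sup>2)"
    using moment \<open>t > 0\<close> not_integrable_integral_eq by fastforce
  then show "square_integrable P (B t)"
    using fractional_brownian_motion_measurable[OF assms(1)] \<open>t > 0\<close>
    by (simp add: square_integrable_def)
qed

text \<open>Evaluation at time \<open>t\<close> is measurable on path space, so independence of the
  processes passes to the variables \<open>B k t\<close>, and the expectation of the product factors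
  into means, which vanish. Time is positive because integrability is drawn from the second
  moment.\<close>

lemma (in prob_space) independent_fbm_uncorrelated:
  assumes fbm: "\<And>k. k \<in> K \<Longrightarrow> fractional_brownian_motion M (H k) (B k)"
    and indep: "independent_processes M B K"
    and "i \<in> K" "j \<in> K" "i \<noteq> j" "t > 0"
  shows "(\<integral>\<omega>. B i t \<omega> * B j t \<omega> \<partial>M) = 0"
proof -
  have "indep_vars (\<lambda>_. borel) (\<lambda>k \<omega>. (\<lambda>s\<in>{0..}. B k s \<omega>) t) K"
    using indep \<open>t > 0\<close> unfolding independent_processes_def
    by (intro indep_vars_compose2[where Y = "\<lambda>_ f. f t" and N = "\<lambda>_. borel"
        and M' = "\<lambda>_. Pi\<^sub>M {0..} (\<lambda>_. borel)" and X = "\<lambda>k \<omega>. \<lambda>s\<in>{0..}. B k s \<omega>"]) auto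
  then have "indep_vars (\<lambda>_. borel) (\<lambda>k. B k t) K"
    using \<open>t > 0\<close> by simp
  then have ij: "indep_vars (\<lambda>_. borel) (\<lambda>k. B k t) {i, j}"
    using \<open>i \<in> K\<close> \<open>j \<in> K\<close> by (auto intro: indep_vars_subset)
  have "integrable M (B k t)" if "k \<in> K" for k
    using fractional_brownian_motion_second_moment(1)[OF fbm[OF that] \<open>t > 0\<close>]
    by (auto simp: square_integrable_def intro: square_integrable_imp_integrable)
  then have "(\<integral>\<omega>. (\<Prod>k\<in>{i, j}. B k t \<omega>) \<partial>M) = (\<Prod>k\<in>{i, j}. \<integral>\<omega>. B k t \<omega> \<partial>M)"
    using \<open>i \<in> K\<close> \<open>j \<in> K\<close> by (intro indep_vars_lebesgue_integral ij) auto
  moreover have "(\<integral>\<omega>. B i t \<omega> \<partial>M) = 0"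
    using fbm[OF \<open>i \<in> K\<close>] \<open>t > 0\<close> by (simp add: fractional_brownian_motion_def)
  ultimately show ?thesis
    using \<open>i \<noteq> j\<close> by simp
qed

text \<open>The constant is free of the Hurst indices, so only the squared coefficients vary with
  the block \<open>A\<close>. The extended nonnegative integral is used so that the bound fits the
  inner integral of Tonelli's theorem.\<close>

lemma (in prob_space) fbm_sum_second_moment_le:
  assumes fbm: "\<And>k. k \<in> K \<Longrightarrow> fractional_brownian_motion M (H k) (B k)"
    and indep: "independent_processes M B K"
    and "finite A" "A \<subseteq> K" "0 < t" "t \<le> T"
  shows "(\<integral>\<^sup>+\<omega>. ennreal ((\<Sum>k\<in>A. \<sigma> k * B k t \<omega>)\<^sup>2) \<partial>M) \<le> ennreal ((1 + T)\<^sup>2 * (\<Sum>k\<in>A. (\<sigma> k)\<^sup>2))"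
proof -
  note moment = fractional_brownian_motion_second_moment[OF fbm \<open>t > 0\<close>]
  have sq: "square_integrable M (\<lambda>\<omega>. \<sigma> k * B k t \<omega>)" if "k \<in> A" for k
    using moment(1)[OF subsetD[OF \<open>A \<subseteq> K\<close> that]] unfolding square_integrable_def
    by (intro conjI borel_measurable_times) (auto simp: power_mult_distrib)
  have uncorr: "(\<integral>\<omega>. (\<sigma> i * B i t \<omega>) * (\<sigma> j * B j t \<omega>) \<partial>M) = 0"
    if "i \<in> A" "j \<in> A" "i \<noteq> j" for i j
  proof -
    have "(\<integral>\<omega>. (\<sigma> i * B i t \<omega>) * (\<sigma> j * B j t \<omega>) \<partial>M) = (\<integral>\<omega>. (\<sigma> i * \<sigma> j) * (B i t \<omega> * B j t \<omega>) \<partial>M)"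
      by (simp add: ac_simps)
    then show ?thesis
      using independent_fbm_uncorrelated[OF fbm indep, of i j t] that \<open>A \<subseteq> K\<close> \<open>t > 0\<close> by auto
  qed
  note sum = uncorrelated_sum_square[OF \<open>finite A\<close> sq uncorr]
  have "(\<integral>\<omega>. (\<Sum>k\<in>A. \<sigma> k * B k t \<omega>)\<^sup>2 \<partial>M) = (\<Sum>k\<in>A. \<integral>\<omega>. (\<sigma> k * B k t \<omega>)\<^sup>2 \<partial>M)"
    by (rule sum(2))
  also have "\<dots> \<le> (\<Sum>k\<in>A. (1 + T)\<^sup>2 * (\<sigma> k)\<^sup>2)"
  proof (rule sum_mono)
    fix k
    assume "k \<in> A"
    then have k: "k \<in> K" "0 < H k" "H k < 1"
      using fbm[of k] \<open>A \<subseteq> K\<close> by (auto simp: fractional_brownian_motion_def)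
    \<comment> \<open>The base is enlarged to \<open>1 + T\<close> rather than \<open>T\<close>: a
      base of at least 1 makes the power increase with the exponent, which allows replacing
      \<open>2 * H k\<close> by 2 even when \<open>T < 1\<close>.\<close>
    have "t powr (2 * H k) \<le> (1 + T) powr (2 * H k)"
      using k \<open>0 < t\<close> \<open>t \<le> T\<close> by (intro powr_mono2) auto
    also have "\<dots> \<le> (1 + T) powr 2"
      using k \<open>0 < t\<close> \<open>t \<le> T\<close> by (intro powr_mono) auto
    also have "\<dots> = (1 + T)\<^sup>2"
      using \<open>0 < t\<close> \<open>t \<le> T\<close> by simp
    finally show "(\<integral>\<omega>. (\<sigma> k * B k t \<omega>)\<^sup>2 \<partial>M) \<le> (1 + T)\<^sup>2 * (\<sigma> k)\<^sup>2"
      using moment(2)[OF k(1)] by (simp add: power_mult_distrib mult.commute mult_left_mono)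
  qed
  also have "\<dots> = (1 + T)\<^sup>2 * (\<Sum>k\<in>A. (\<sigma> k)\<^sup>2)"
    by (simp add: sum_distrib_left)
  finally show ?thesis
    using sum(1) by (subst nn_integral_eq_integral) (auto simp: square_integrable_def intro: ennreal_leI)
qed

text \<open>A single Tonelli computation serves both claims: the finite nonnegative integral yields
  integrability, and then the same bound is read off for the real integral.\<close>

lemma (in prob_space) fbm_sum_L2_bound:
  assumes fbm: "\<And>k. k \<in> K \<Longrightarrow> fractional_brownian_motion M (H k) (B k)"
    and indep: "independent_processes M B K"
    and "finite A" "A \<subseteq> K" "T > 0"
  defines "N \<equiv> M \<Otimes>\<^sub>M restrict_space lborel {0..T}"
  shows "square_integrable N (\<lambda>(\<omega>, t). \<Sum>k\<in>A. \<sigma> k * B k t \<omega>)"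
    and "(\<integral>(\<omega>, t). (\<Sum>k\<in>A. \<sigma> k * B k t \<omega>)\<^sup>2 \<partial>N) \<le> (1 + T)\<^sup>2 * T * (\<Sum>k\<in>A. (\<sigma> k)\<^sup>2)"
proof -
  interpret L: finite_measure "restrict_space lborel {0..T}"
    using \<open>T > 0\<close>
    by (intro finite_measureI) (simp add: emeasure_restrict_space space_restrict_space)
  interpret pair_sigma_finite M "restrict_space lborel {0..T}" ..
  let ?S = "\<lambda>(\<omega>, t). \<Sum>k\<in>A. \<sigma> k * B k t \<omega>"
  let ?s = "\<Sum>k\<in>A. (\<sigma> k)\<^sup>2"
  have "(\<lambda>(\<omega>, t). B k t \<omega>) \<in> borel_measurable N" if "k \<in> A" for k
  proof -
    have "fractional_brownian_motion M (H k) (B k)"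
      using fbm that \<open>A \<subseteq> K\<close> by auto
    \<comment> \<open>Continuity of every path, part of the definition of fractional Brownian
      motion, enters here.\<close>
    then show ?thesis
      unfolding N_def
      by (intro continuous_paths_measurable_pair fractional_brownian_motion_measurable)
         (auto simp: fractional_brownian_motion_def)
  qed
  then have meas [measurable]: "?S \<in> borel_measurable N"
    unfolding case_prod_beta by (intro borel_measurable_sum borel_measurable_times) auto
  \<comment> \<open>The moment bound covers positive times only; time 0 is a Lebesgue null
    set.\<close>
  have "AE t in lborel. t \<noteq> (0::real)"
    by (rule AE_lborel_singleton)
  then have AE_pos: "AE t in restrict_space lborel {0..T}. 0 < t \<and> t \<le> T"
    by (subst AE_restrict_space_iff) auto
  \<comment> \<open>Time is the outer variable, so that the inner integral is an expectation at a
    fixed time.\<close>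
  have "(\<integral>\<^sup>+p. ennreal ((?S p)\<^sup>2) \<partial>N)
      = (\<integral>\<^sup>+t. (\<integral>\<^sup>+\<omega>. ennreal ((\<Sum>k\<in>A. \<sigma> k * B k t \<omega>)\<^sup>2) \<partial>M) \<partial>restrict_space lborel {0..T})"
    using meas unfolding N_def by (subst nn_integral_snd[symmetric]) auto
  also have "\<dots> \<le> (\<integral>\<^sup>+t. ennreal ((1 + T)\<^sup>2 * ?s) \<partial>restrict_space lborel {0..T})"
    using AE_pos
    by (intro nn_integral_mono_AE, elim eventually_mono)
       (auto intro: fbm_sum_second_moment_le[OF fbm indep \<open>finite A\<close> \<open>A \<subseteq> K\<close>])
  also have "\<dots> = ennreal ((1 + T)\<^sup>2 * T * ?s)"
    using \<open>T > 0\<close>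
    by (simp add: emeasure_restrict_space space_restrict_space sum_nonneg ac_simps flip: ennreal_mult)
  finally have bound: "(\<integral>\<^sup>+p. ennreal ((?S p)\<^sup>2) \<partial>N) \<le> ennreal ((1 + T)\<^sup>2 * T * ?s)" .
  then have int: "integrable N (\<lambda>p. (?S p)\<^sup>2)"
    by (intro integrableI_bounded) (auto simp: order.strict_trans1)
  then show "square_integrable N ?S"
    using meas by (simp add: square_integrable_def)
  have "(\<integral>p. (?S p)\<^sup>2 \<partial>N) \<le> (1 + T)\<^sup>2 * T * ?s"
    using bound int \<open>T > 0\<close> by (subst (asm) nn_integral_eq_integral) (auto simp: sum_nonneg)
  then show "(\<integral>(\<omega>, t). (\<Sum>k\<in>A. \<sigma> k * B k t \<omega>)\<^sup>2 \<partial>N) \<le> (1 + T)\<^sup>2 * T * ?s"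
    by (simp add: case_prod_unfold)
qed

section \<open>The Cauchy property of the partial sums\<close>

theorem proposition2p1:
  fixes P :: "'a measure"
    and \<sigma> H :: "nat \<Rightarrow> real"
    and B :: "nat \<Rightarrow> real \<Rightarrow> 'a \<Rightarrow> real"
  assumes "prob_space P"
    and "\<And>k. k \<ge> 1 \<Longrightarrow> \<sigma> k > 0"
    and "summable (\<lambda>k. (\<sigma> (Suc k))\<^sup>2)"
    and "inj_on H {1..}"
    and "\<And>k. k \<ge> 1 \<Longrightarrow> 0 < H k \<and> H k < 1"
    and "(INF k\<in>{1..}. H k) > 0"
    and "(SUP k\<in>{1..}. H k) < 1"
    and "\<And>k. k \<ge> 1 \<Longrightarrow> fractional_brownian_motion P (H k) (B k)"
    and "independent_processes P B {1..}"
  shows "\<forall>T>0. \<exists>M :: 'a \<times> real \<Rightarrow> real.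
           converges_in_L2 (P \<Otimes>\<^sub>M restrict_space lborel {0..T})
             (\<lambda>n (\<omega>, t). \<Sum>k=1..n. \<sigma> k * B k t \<omega>) M"
proof (intro allI impI)
  fix T :: real
  assume "T > 0"
  interpret prob_space P
    by fact
  interpret L: finite_measure "restrict_space lborel {0..T}"
    using \<open>T > 0\<close>
    by (intro finite_measureI) (simp add: emeasure_restrict_space space_restrict_space)
  let ?N = "P \<Otimes>\<^sub>M restrict_space lborel {0..T}"
  let ?S = "\<lambda>n (\<omega>, t). \<Sum>k=1..n. \<sigma> k * B k t \<omega>"
  let ?s = "\<lambda>n. \<Sum>k=1..n. (\<sigma> k)\<^sup>2"
  define C where "C = (1 + T)\<^sup>2 * T"
  have "C > 0"
    using \<open>T > 0\<close> by (simp add: C_def)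
  \<comment> \<open>The bounded time interval makes the product measure finite, as
    \<open>L2_complete\<close> requires.\<close>
  interpret N: finite_measure ?N
    by (intro finite_measure_pair_measure L.finite_measure_axioms finite_measure_axioms)
  have fbm: "\<And>k. k \<in> {1..} \<Longrightarrow> fractional_brownian_motion P (H k) (B k)"
    using assms(8) by auto
  note bound = fbm_sum_L2_bound[OF fbm assms(9) _ _ \<open>T > 0\<close>, where \<sigma> = \<sigma>, folded C_def]
  \<comment> \<open>Controlling distances by the numerical partial sums \<open>?s\<close> transfers
    their Cauchy property to \<open>?S\<close>. Both sides are symmetric in \<open>m\<close> and
    \<open>n\<close>, so the case \<open>m \<le> n\<close> suffices.\<close>
  have diff: "(\<integral>p. (?S m p - ?S n p)\<^sup>2 \<partial>?N) \<le> C * \<bar>?s m - ?s n\<bar>" for m n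
  proof (induction m n rule: linorder_wlog)
    case (le m n)
    have split: "(\<Sum>k=1..n. f k) = (\<Sum>k=1..m. f k) + (\<Sum>k=Suc m..n. f k)" for f :: "nat \<Rightarrow> real"
      using le sum.ub_add_nat[of 1 m f "n - m"] by simp
    \<comment> \<open>The difference is minus the block from \<open>Suc m\<close> to
      \<open>n\<close>; the square absorbs the sign.\<close>
    have "(\<integral>p. (?S m p - ?S n p)\<^sup>2 \<partial>?N) = (\<integral>(\<omega>, t). (\<Sum>k=Suc m..n. \<sigma> k * B k t \<omega>)\<^sup>2 \<partial>?N)"
      by (simp add: split case_prod_unfold del: One_nat_def)
    also have "\<dots> \<le> C * (\<Sum>k=Suc m..n. (\<sigma> k)\<^sup>2)"
      by (rule bound(2)) auto
    finally show ?case
      by (simp add: split sum_nonneg del: One_nat_def)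
  next
    case (sym m n)
    then show ?case
      by (subst power2_commute, subst abs_minus_commute)
  qed
  \<comment> \<open>The summability hypothesis indexes from 0 through \<open>Suc k\<close>;
    reindexing gives the sums over \<open>1..n\<close>.\<close>
  have "Cauchy ?s"
    using assms(3)
    by (simp add: sum.atLeast1_atMost_eq summable_iff_convergent Cauchy_convergent_iff)
  have cauchy: "\<exists>n0. \<forall>m\<ge>n0. \<forall>n\<ge>n0. (\<integral>p. (?S m p - ?S n p)\<^sup>2 \<partial>?N) \<le> e" if "e > 0" for e
  proof -
    obtain n0 where n0: "\<And>m n. m \<ge> n0 \<Longrightarrow> n \<ge> n0 \<Longrightarrow> \<bar>?s m - ?s n\<bar> < e / C"
      using CauchyD[OF \<open>Cauchy ?s\<close>, of "e / C"] \<open>e > 0\<close> \<open>C > 0\<close> by auto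
    have "(\<integral>p. (?S m p - ?S n p)\<^sup>2 \<partial>?N) \<le> e" if "m \<ge> n0" "n \<ge> n0" for m n
      using diff[of m n] n0[OF that] \<open>C > 0\<close> by (simp add: field_simps)
    then show ?thesis
      by blast
  qed
  have sq: "square_integrable ?N (?S n)" for n
    by (rule bound(1)) auto
  obtain M where "converges_in_L2 ?N ?S M"
    by (rule N.L2_complete[OF sq cauchy])
  then show "\<exists>M. converges_in_L2 ?N ?S M"
    by blast
qed

end
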